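(* An abstract logic $\langle\mathbf A,\mathbf C\rangle$ (with $\mathbf A$ an algebra of type $\{\land,\lor,\otimes,\oplus,\neg\}$) is a full model of $\mathcal{LB}$ if and only if it is finitary and satisfies, for all $a,b\in A$ and all $X\subseteq A$, the following properties: (E) $\mathbf C(\emptyset)=\emptyset$; (PC) $\mathbf C(a\land b)=\mathbf C(a\otimes b)=\mathbf C(a,b)$; (PDI) $\mathbf C(X,a\lor b)=\mathbf C(X,a\oplus b)=\mathbf C(X,a)\cap\mathbf C(X,b)$; (PDN) $\mathbf C(a)=\mathbf C(\neg\neg a)$; (PDM) $\mathbf C(\neg(a\land b))=\mathbf C(\neg a\lor\neg b)$, $\mathbf C(\neg(a\lor b))=\mathbf C(\neg a\land\neg b)$, $\mathbf C(\neg(a\otimes b))=\mathbf C(\neg a\otimes\neg b)$, $\mathbf C(\neg(a\oplus b))=\mathbf C(\neg a\oplus\neg b)$.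
   Context: $\mathcal{FOUR}$ is the algebra with universe $\{\mathsf f,\bot,\top,\mathsf t\}$ where $\land,\lor$ are meet and join of the lattice order $\leq_t$ with $\mathsf f <_t \bot,\top <_t \mathsf t$ ($\bot,\top$ $\leq_t$-incomparable), $\otimes,\oplus$ are meet and join of the lattice order $\leq_k$ with $\bot <_k \mathsf f,\mathsf t <_k \top$ ($\mathsf f,\mathsf t$ $\leq_k$-incomparable), and $\neg \mathsf f = \mathsf t$, $\neg\mathsf t=\mathsf f$, $\neg\bot=\bot$, $\neg\top=\top$. Let $\mathsf{Tr}=\{\top,\mathsf t\}$. $\mathbf{Fm}$ is the formula algebra over a countable set of variables in the language $\{\land,\lor,\otimes,\oplus,\neg\}$ (no constants), and $\mathcal{LB}$ is the logic given by: $\Gamma\models_{\mathcal{LB}}\varphi$ iff for every homomorphism $h:\mathbf{Fm}\to\mathcal{FOUR}$, $h[\Gamma]\subseteq \mathsf{Tr}$ implies $h(\varphi)\in\mathsf{Tr}$. A set $F\subseteq A$ is an $\mathcal{LB}$-filter of $\mathbf A$ if whenever $\Gamma\models_{\mathcal{LB}}\varphi$ and $h:\mathbf{Fm}\to\mathbf A$ is a homomorphism with $h[\Gamma]\subseteq F$, then $h(\varphi)\in F$; $\mathcal Fi_{\mathcal{LB}}\mathbf A$ is the closure system of all $\mathcal{LB}$-filters of $\mathbf A$. An abstract logic is a pair $\langle\mathbf A,\mathbf C\rangle$ with $\mathbf C$ a closure operator on $A$ (identified with the corresponding closure system); it is finitary if $a\in\mathbf C(X)$ implies $a\in\mathbf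 C(X_0)$ for some finite $X_0\subseteq X$. Notation: $\mathbf C(X,a)=\mathbf C(X\cup\{a\})$. A bilogical morphism from $\langle\mathbf A,\mathbf C\rangle$ to $\langle\mathbf A',\mathbf C'\rangle$ is a surjective homomorphism $h:\mathbf A\to\mathbf A'$ such that for all $X\cup\{a\}\subseteq A$: $a\in\mathbf C(X)$ iff $h(a)\in\mathbf C'(h[X])$. $\langle\mathbf A,\mathbf C\rangle$ is a full model of $\mathcal{LB}$ if there is a bilogical morphism from it to some abstract logic whose closure system is of the form $\mathcal Fi_{\mathcal{LB}}\mathbf A'$ on an algebra $\mathbf A'$. *)

theory Defs
  imports Main
begin

record 'a alg =
  carrier :: "'a set"
  land :: "'a \<Rightarrow> 'a \<Rightarrow> 'a" (infixl "\<^bold>\<and>\<index>" 70)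
  lor :: "'a \<Rightarrow> 'a \<Rightarrow> 'a" (infixl "\<^bold>\<or>\<index>" 65)
  otimes :: "'a \<Rightarrow> 'a \<Rightarrow> 'a" (infixl "\<otimes>\<index>" 70)
  oplus :: "'a \<Rightarrow> 'a \<Rightarrow> 'a" (infixl "\<oplus>\<index>" 65)
  lneg :: "'a \<Rightarrow> 'a" ("\<^bold>\<not>\<index> _" [81] 80)

text \<open>The signature has no constants, and the empty carrier is not excluded.\<close>

definition algebra :: "'a alg \<Rightarrow> bool" where
  "algebra A \<longleftrightarrow>
     (\<forall>a \<in> carrier A. \<^bold>\<not>\<^bsub>A\<^esub> a \<in> carrier A) \<and>
     (\<forall>a \<in> carrier A. \<forall>b \<in> carrier A.
        a \<^bold>\<and>\<^bsub>A\<^esub> b \<in> carrier A \<and> a \<^bold>\<or>\<^bsub>A\<^esub> b \<in> carrier A \<and>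
        a \<otimes>\<^bsub>A\<^esub> b \<in> carrier A \<and> a \<oplus>\<^bsub>A\<^esub> b \<in> carrier A)"

definition homomorphism :: "'a alg \<Rightarrow> 'b alg \<Rightarrow> ('a \<Rightarrow> 'b) \<Rightarrow> bool" where
  "homomorphism A B h \<longleftrightarrow>
     (\<forall>a \<in> carrier A. h a \<in> carrier B) \<and>
     (\<forall>a \<in> carrier A. h (\<^bold>\<not>\<^bsub>A\<^esub> a) = \<^bold>\<not>\<^bsub>B\<^esub> (h a)) \<and>
     (\<forall>a \<in> carrier A. \<forall>b \<in> carrier A.
        h (a \<^bold>\<and>\<^bsub>A\<^esub> b) = h a \<^bold>\<and>\<^bsub>B\<^esub> h b \<and>
        h (a \<^bold>\<or>\<^bsub>A\<^esub> b) = h a \<^bold>\<or>\<^bsub>B\<^esub> h b \<and>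
        h (a \<otimes>\<^bsub>A\<^esub> b) = h a \<otimes>\<^bsub>B\<^esub> h b \<and>
        h (a \<oplus>\<^bsub>A\<^esub> b) = h a \<oplus>\<^bsub>B\<^esub> h b)"

datatype four = Ff | Bot | Top | Tt

definition le_t :: "four \<Rightarrow> four \<Rightarrow> bool" where
  "le_t x y \<longleftrightarrow> x = y \<or> x = Ff \<or> y = Tt"

definition le_k :: "four \<Rightarrow> four \<Rightarrow> bool" where
  "le_k x y \<longleftrightarrow> x = y \<or> x = Bot \<or> y = Top"

definition is_meet :: "('a \<Rightarrow> 'a \<Rightarrow> bool) \<Rightarrow> 'a \<Rightarrow> 'a \<Rightarrow> 'a \<Rightarrow> bool" where
  "is_meet le x y z \<longleftrightarrow> le z x \<and> le z y \<and> (\<forall>w. le w x \<and> le w y \<longrightarrow> le w z)"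

definition is_join :: "('a \<Rightarrow> 'a \<Rightarrow> bool) \<Rightarrow> 'a \<Rightarrow> 'a \<Rightarrow> 'a \<Rightarrow> bool" where
  "is_join le x y z \<longleftrightarrow> le x z \<and> le y z \<and> (\<forall>w. le x w \<and> le y w \<longrightarrow> le z w)"

fun neg4 :: "four \<Rightarrow> four" where
  "neg4 Ff = Tt"
| "neg4 Tt = Ff"
| "neg4 Bot = Bot"
| "neg4 Top = Top"

definition FOUR :: "four alg" where
  "FOUR = \<lparr> carrier = UNIV,
     land = (\<lambda>x y. THE z. is_meet le_t x y z),
     lor = (\<lambda>x y. THE z. is_join le_t x y z),
     otimes = (\<lambda>x y. THE z. is_meet le_k x y z),
     oplus = (\<lambda>x y. THE z. is_join le_k x y z),
     lneg = neg4 \<rparr>"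

definition Tr :: "four set" where
  "Tr = {Top, Tt}"

text \<open>The descriptions in the definition of \<open>FOUR\<close> are proper: all meets and joins exist and
  are unique.\<close>

lemma four_lattices:
  "\<exists>!z. is_meet le_t x y z" "\<exists>!z. is_join le_t x y z"
  "\<exists>!z. is_meet le_k x y z" "\<exists>!z. is_join le_k x y z"
proof -
  have all4: "(\<forall>w. P w) \<longleftrightarrow> P Ff \<and> P Bot \<and> P Top \<and> P Tt" for P
    by (metis four.exhaust)
  have ex4: "(\<exists>w. P w) \<longleftrightarrow> P Ff \<or> P Bot \<or> P Top \<or> P Tt" for P
    by (metis four.exhaust)
  show "\<exists>!z. is_meet le_t x y z" "\<exists>!z. is_join le_t x y z"
    "\<exists>!z. is_meet le_k x y z" "\<exists>!z. is_join le_k x y z"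
    unfolding Ex1_def is_meet_def is_join_def le_t_def le_k_def
    by (cases x; cases y; simp add: all4 ex4)+
qed

datatype fm =
    Var nat
  | And fm fm
  | Or fm fm
  | Otimes fm fm
  | Oplus fm fm
  | Neg fm

definition Fm :: "fm alg" where
  "Fm = \<lparr> carrier = UNIV, land = And, lor = Or, otimes = Otimes, oplus = Oplus, lneg = Neg \<rparr>"

definition LB_entails :: "fm set \<Rightarrow> fm \<Rightarrow> bool" where
  "LB_entails \<Gamma> \<phi> \<longleftrightarrow> (\<forall>h. homomorphism Fm FOUR h \<longrightarrow> h ` \<Gamma> \<subseteq> Tr \<longrightarrow> h \<phi> \<in> Tr)"

definition LB_filter :: "'a alg \<Rightarrow> 'a set \<Rightarrow> bool" where
  "LB_filter A F \<longleftrightarrow> F \<subseteq> carrier A \<and>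
     (\<forall>\<Gamma> \<phi> h. LB_entails \<Gamma> \<phi> \<longrightarrow> homomorphism Fm A h \<longrightarrow> h ` \<Gamma> \<subseteq> F \<longrightarrow> h \<phi> \<in> F)"

text \<open>Only the values of \<open>C\<close> on subsets of \<open>S\<close> matter.\<close>

definition closure_operator_on :: "'a set \<Rightarrow> ('a set \<Rightarrow> 'a set) \<Rightarrow> bool" where
  "closure_operator_on S C \<longleftrightarrow>
     (\<forall>X. X \<subseteq> S \<longrightarrow> C X \<subseteq> S \<and> X \<subseteq> C X \<and> C (C X) = C X) \<and>
     (\<forall>X Y. X \<subseteq> Y \<longrightarrow> Y \<subseteq> S \<longrightarrow> C X \<subseteq> C Y)"

definition closure_system :: "'a set \<Rightarrow> ('a set \<Rightarrow> 'a set) \<Rightarrow> 'a set set" where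
  "closure_system S C = {X. X \<subseteq> S \<and> C X = X}"

definition abstract_logic :: "'a alg \<Rightarrow> ('a set \<Rightarrow> 'a set) \<Rightarrow> bool" where
  "abstract_logic A C \<longleftrightarrow> algebra A \<and> closure_operator_on (carrier A) C"

definition finitary :: "'a alg \<Rightarrow> ('a set \<Rightarrow> 'a set) \<Rightarrow> bool" where
  "finitary A C \<longleftrightarrow>
     (\<forall>X a. X \<subseteq> carrier A \<longrightarrow> a \<in> C X \<longrightarrow> (\<exists>X0. X0 \<subseteq> X \<and> finite X0 \<and> a \<in> C X0))"

definition bilogical_morphism ::
  "'a alg \<Rightarrow> ('a set \<Rightarrow> 'a set) \<Rightarrow> 'b alg \<Rightarrow> ('b set \<Rightarrow> 'b set) \<Rightarrow> ('a \<Rightarrow> 'b) \<Rightarrow> bool" where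
  "bilogical_morphism A C A' C' h \<longleftrightarrow>
     homomorphism A A' h \<and> h ` carrier A = carrier A' \<and>
     (\<forall>X a. X \<subseteq> carrier A \<longrightarrow> a \<in> carrier A \<longrightarrow> (a \<in> C X \<longleftrightarrow> h a \<in> C' (h ` X)))"

definition full_model_via ::
  "'a alg \<Rightarrow> ('a set \<Rightarrow> 'a set) \<Rightarrow> 'b alg \<Rightarrow> ('b set \<Rightarrow> 'b set) \<Rightarrow> ('a \<Rightarrow> 'b) \<Rightarrow> bool" where
  "full_model_via A C A' C' h \<longleftrightarrow>
     abstract_logic A' C' \<and> closure_system (carrier A') C' = {F. LB_filter A' F} \<and>
     bilogical_morphism A C A' C' h"

text \<open>The target algebra ranges over algebras whose carrier is a subset of the type of the
  source. As it is a homomorphic image of the source, this is no restriction: see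
  \<open>full_modelI\<close> below, where the target may live in any type.\<close>

definition full_model :: "'a alg \<Rightarrow> ('a set \<Rightarrow> 'a set) \<Rightarrow> bool" where
  "full_model A C \<longleftrightarrow> (\<exists>(A' :: 'a alg) C' h. full_model_via A C A' C' h)"

lemma full_modelI:
  fixes A :: "'a alg" and A' :: "'b alg"
  assumes "full_model_via A C A' C' h"
  shows "full_model A C"
proof -
  have alg: "algebra A'" and clo: "closure_operator_on (carrier A') C'"
    and sys: "closure_system (carrier A') C' = {F. LB_filter A' F}"
    and hom: "homomorphism A A' h" and surj: "h ` carrier A = carrier A'"
    and bil: "\<And>X a. X \<subseteq> carrier A \<Longrightarrow> a \<in> carrier A \<Longrightarrow> a \<in> C X \<longleftrightarrow> h a \<in> C' (h ` X)"
    using assms by (auto simp: full_model_via_def abstract_logic_def bilogical_morphism_def)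
  define g where "g = inv_into (carrier A) h"
  have hg: "h (g y) = y" if "y \<in> carrier A'" for y
    using that surj by (simp add: g_def f_inv_into_f)
  define B where "B = \<lparr> carrier = g ` carrier A',
     land = (\<lambda>x y. g (h x \<^bold>\<and>\<^bsub>A'\<^esub> h y)), lor = (\<lambda>x y. g (h x \<^bold>\<or>\<^bsub>A'\<^esub> h y)),
     otimes = (\<lambda>x y. g (h x \<otimes>\<^bsub>A'\<^esub> h y)), oplus = (\<lambda>x y. g (h x \<oplus>\<^bsub>A'\<^esub> h y)),
     lneg = (\<lambda>x. g (\<^bold>\<not>\<^bsub>A'\<^esub> (h x))) \<rparr>"
  have cB: "carrier B = g ` carrier A'" by (simp add: B_def)
  have hB: "h x \<in> carrier A'" "g (h x) = x" if "x \<in> carrier B" for x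
    using that hg by (auto simp: cB)
  define D where "D X = g ` C' (h ` X)" for X
  have gh: "g ` h ` X = X" if "X \<subseteq> carrier B" for X
    using that hB(2) by (force simp: image_image)
  have hgi: "h ` g ` Y = Y" if "Y \<subseteq> carrier A'" for Y
    using that hg by (force simp: image_image)
  have hX: "h ` X \<subseteq> carrier A'" if "X \<subseteq> carrier B" for X
    using that hB(1) by blast
  have Csub: "C' Y \<subseteq> carrier A'" if "Y \<subseteq> carrier A'" for Y
    using that clo by (auto simp: closure_operator_on_def)
  have algB: "algebra B"
    using alg hg by (simp add: algebra_def B_def)
  have "D X \<subseteq> carrier B \<and> X \<subseteq> D X \<and> D (D X) = D X" if X: "X \<subseteq> carrier B" for X
  proof -
    have 1: "h ` X \<subseteq> C' (h ` X)" "C' (C' (h ` X)) = C' (h ` X)"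
      using clo hX[OF X] by (auto simp: closure_operator_on_def)
    have "X \<subseteq> D X"
      using image_mono[OF 1(1), of g] gh[OF X] by (simp add: D_def)
    moreover have "D X \<subseteq> carrier B"
      using Csub[OF hX[OF X]] by (auto simp: D_def cB)
    moreover have "D (D X) = D X"
      using hgi[OF Csub[OF hX[OF X]]] 1(2) by (simp add: D_def)
    ultimately show ?thesis by blast
  qed
  moreover have "D X \<subseteq> D Y" if "X \<subseteq> Y" "Y \<subseteq> carrier B" for X Y
    using clo hX[OF that(2)] that(1) unfolding D_def closure_operator_on_def
    by (meson image_mono)
  ultimately have cloB: "closure_operator_on (carrier B) D"
    by (auto simp: closure_operator_on_def)
  have homg: "homomorphism A' B g"
    using hg alg by (simp add: homomorphism_def B_def algebra_def)
  have homh: "homomorphism B A' h"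
    using hg alg by (simp add: homomorphism_def B_def algebra_def)
  have comp: "homomorphism P R (v \<circ> u)" if "homomorphism P Q u" "homomorphism Q R v"
    for P :: "'p alg" and Q :: "'q alg" and R :: "'r alg" and u v
    using that by (simp add: homomorphism_def)
  have fil: "LB_filter B X \<longleftrightarrow> LB_filter A' (h ` X)" if X: "X \<subseteq> carrier B" for X
  proof
    assume L: "LB_filter B X"
    show "LB_filter A' (h ` X)"
      unfolding LB_filter_def
    proof (intro conjI allI impI)
      show "h ` X \<subseteq> carrier A'" by (rule hX[OF X])
      fix \<Gamma> \<phi> k
      assume *: "LB_entails \<Gamma> \<phi>" "homomorphism Fm A' k" "k ` \<Gamma> \<subseteq> h ` X"
      have "(g \<circ> k) ` \<Gamma> \<subseteq> X"
        using image_mono[OF *(3), of g] gh[OF X] by (simp add: image_comp)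
      then have "(g \<circ> k) \<phi> \<in> X"
        using L *(1) comp[OF *(2) homg] unfolding LB_filter_def by blast
      moreover have "h (g (k \<phi>)) = k \<phi>"
        using *(2) by (intro hg) (simp add: homomorphism_def Fm_def)
      ultimately show "k \<phi> \<in> h ` X" by (metis comp_apply imageI)
    qed
  next
    assume L: "LB_filter A' (h ` X)"
    show "LB_filter B X"
      unfolding LB_filter_def
    proof (intro conjI allI impI)
      show "X \<subseteq> carrier B" by (rule X)
      fix \<Gamma> \<phi> k
      assume *: "LB_entails \<Gamma> \<phi>" "homomorphism Fm B k" "k ` \<Gamma> \<subseteq> X"
      have "(h \<circ> k) ` \<Gamma> \<subseteq> h ` X"
        using *(3) by auto
      then have "(h \<circ> k) \<phi> \<in> h ` X"
        using L *(1) comp[OF *(2) homh] unfolding LB_filter_def by blast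
      then have "g (h (k \<phi>)) \<in> g ` h ` X" by simp
      moreover have "g (h (k \<phi>)) = k \<phi>"
        using *(2) by (intro hB(2)) (simp add: homomorphism_def Fm_def)
      ultimately show "k \<phi> \<in> X" using gh[OF X] by simp
    qed
  qed
  have closed: "D X = X \<longleftrightarrow> C' (h ` X) = h ` X" if X: "X \<subseteq> carrier B" for X
    using gh[OF X] hgi[OF Csub[OF hX[OF X]]] unfolding D_def by metis
  have "X \<in> closure_system (carrier B) D \<longleftrightarrow> LB_filter B X" for X
  proof (cases "X \<subseteq> carrier B")
    case True
    have "LB_filter A' (h ` X) \<longleftrightarrow> h ` X \<in> closure_system (carrier A') C'"
      using sys by simp
    then show ?thesis
      using True hX[OF True] closed[OF True] fil[OF True] by (simp add: closure_system_def)
  qed (simp add: closure_system_def LB_filter_def)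
  then have sysB: "closure_system (carrier B) D = {F. LB_filter B F}" by blast
  have "bilogical_morphism A C B D (g \<circ> h)"
    unfolding bilogical_morphism_def
  proof (intro conjI allI impI)
    show "homomorphism A B (g \<circ> h)" by (rule comp[OF hom homg])
    show "(g \<circ> h) ` carrier A = carrier B"
      using surj by (simp only: cB image_comp[symmetric])
    fix X a
    assume X: "X \<subseteq> carrier A" and a: "a \<in> carrier A"
    have hXA: "h ` X \<subseteq> carrier A'" using X surj by blast
    have ha: "h a \<in> carrier A'" using a surj by blast
    have "D ((g \<circ> h) ` X) = g ` C' (h ` X)"
      using hgi[OF hXA] by (simp only: D_def image_comp[symmetric])
    moreover have "g (h a) \<in> g ` C' (h ` X) \<longleftrightarrow> h a \<in> C' (h ` X)"
      using hg[OF ha] hgi[OF Csub[OF hXA]] by (metis imageI)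
    ultimately show "a \<in> C X \<longleftrightarrow> (g \<circ> h) a \<in> D ((g \<circ> h) ` X)"
      using bil[OF X a] by simp
  qed
  then have "full_model_via A C B D (g \<circ> h)"
    using algB cloB sysB by (simp add: full_model_via_def abstract_logic_def)
  then show ?thesis unfolding full_model_def by blast
qed

end

theory Submission imports Defs begin

text \<open>Filters of the form \<open>{x. x \<or> c \<in> F}\<close> show that the closure operator of all filters has
  the properties. Conversely, Zorn's lemma separates points from closed sets by prime closed sets,
  and each prime closed set \<open>P\<close> gives the homomorphism \<open>x \<mapsto> (x \<in> P, \<not>x \<in> P)\<close> into
  \<open>FOUR\<close>, so closed sets are filters; applied to the finitary part of the operator of all filters,
  this also gives finitarity. On the image of \<open>x \<mapsto> (C {x}, C {\<not>x})\<close> all filters are closed: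
  if \<open>a \<in> C {c}\<close> then \<open>c \<and> (c \<oplus> a)\<close> and \<open>c \<and> a\<close> have the same image.\<close>

section \<open>The four truth values in Boolean coordinates\<close>

text \<open>The bits record whether the value and its negation are designated. These are the
  coordinates that a prime closed set will provide.\<close>

definition val :: "bool \<Rightarrow> bool \<Rightarrow> four" where
  "val p n = (if p then if n then Top else Tt else if n then Ff else Bot)"

lemma all_four: "(\<forall>w. P w) \<longleftrightarrow> P Ff \<and> P Bot \<and> P Top \<and> P Tt"
  by (metis four.exhaust)

lemma val_in_Tr [simp]: "val p n \<in> Tr \<longleftrightarrow> p"
  by (simp add: val_def Tr_def)

lemma val_cases: obtains p n where "x = val p n"
  by (cases x) (metis val_def)+

text \<open>In these coordinates \<open>le_k\<close> is the product of the two Boolean orders, and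
  \<open>le_t\<close> is the same product with the second factor reversed. Meets and joins are
  therefore bitwise, and negation exchanges the bits.\<close>

lemma FOUR_val [simp]:
  "val p n \<^bold>\<and>\<^bsub>FOUR\<^esub> val q m = val (p \<and> q) (n \<or> m)"
  "val p n \<^bold>\<or>\<^bsub>FOUR\<^esub> val q m = val (p \<or> q) (n \<and> m)"
  "val p n \<otimes>\<^bsub>FOUR\<^esub> val q m = val (p \<and> q) (n \<and> m)"
  "val p n \<oplus>\<^bsub>FOUR\<^esub> val q m = val (p \<or> q) (n \<or> m)"
  "\<^bold>\<not>\<^bsub>FOUR\<^esub> val p n = val n p"
proof -
  have "is_meet le_t (val p n) (val q m) (val (p \<and> q) (n \<or> m))"
    "is_join le_t (val p n) (val q m) (val (p \<or> q) (n \<and> m))"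
    "is_meet le_k (val p n) (val q m) (val (p \<and> q) (n \<and> m))"
    "is_join le_k (val p n) (val q m) (val (p \<or> q) (n \<or> m))"
    unfolding is_meet_def is_join_def le_t_def le_k_def val_def by (simp_all add: all_four)
  then show
    "val p n \<^bold>\<and>\<^bsub>FOUR\<^esub> val q m = val (p \<and> q) (n \<or> m)"
    "val p n \<^bold>\<or>\<^bsub>FOUR\<^esub> val q m = val (p \<or> q) (n \<and> m)"
    "val p n \<otimes>\<^bsub>FOUR\<^esub> val q m = val (p \<and> q) (n \<and> m)"
    "val p n \<oplus>\<^bsub>FOUR\<^esub> val q m = val (p \<or> q) (n \<or> m)"
    by (simp_all add: FOUR_def the1_equality[OF four_lattices(1)]
        the1_equality[OF four_lattices(2)] the1_equality[OF four_lattices(3)]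
        the1_equality[OF four_lattices(4)])
qed (simp add: FOUR_def val_def)

lemma carrier_FOUR [simp]: "carrier FOUR = UNIV"
  by (simp add: FOUR_def)

lemma lneg_lneg_FOUR [simp]: "\<^bold>\<not>\<^bsub>FOUR\<^esub> (\<^bold>\<not>\<^bsub>FOUR\<^esub> x) = x"
  by (cases x rule: val_cases) simp

text \<open>Designation is evaluated recursively, a negated compound being read off the second bit.
  This reduces the entailments needed later to propositional logic.\<close>

lemma FOUR_in_Tr [simp]:
  "x \<^bold>\<and>\<^bsub>FOUR\<^esub> y \<in> Tr \<longleftrightarrow> x \<in> Tr \<and> y \<in> Tr"
  "x \<^bold>\<or>\<^bsub>FOUR\<^esub> y \<in> Tr \<longleftrightarrow> x \<in> Tr \<or> y \<in> Tr"
  "x \<otimes>\<^bsub>FOUR\<^esub> y \<in> Tr \<longleftrightarrow> x \<in> Tr \<and> y \<in> Tr"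
  "x \<oplus>\<^bsub>FOUR\<^esub> y \<in> Tr \<longleftrightarrow> x \<in> Tr \<or> y \<in> Tr"
  "\<^bold>\<not>\<^bsub>FOUR\<^esub> (x \<^bold>\<and>\<^bsub>FOUR\<^esub> y) \<in> Tr \<longleftrightarrow> \<^bold>\<not>\<^bsub>FOUR\<^esub> x \<in> Tr \<or> \<^bold>\<not>\<^bsub>FOUR\<^esub> y \<in> Tr"
  "\<^bold>\<not>\<^bsub>FOUR\<^esub> (x \<^bold>\<or>\<^bsub>FOUR\<^esub> y) \<in> Tr \<longleftrightarrow> \<^bold>\<not>\<^bsub>FOUR\<^esub> x \<in> Tr \<and> \<^bold>\<not>\<^bsub>FOUR\<^esub> y \<in> Tr"
  "\<^bold>\<not>\<^bsub>FOUR\<^esub> (x \<otimes>\<^bsub>FOUR\<^esub> y) \<in> Tr \<longleftrightarrow> \<^bold>\<not>\<^bsub>FOUR\<^esub> x \<in> Tr \<and> \<^bold>\<not>\<^bsub>FOUR\<^esub> y \<in> Tr"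
  "\<^bold>\<not>\<^bsub>FOUR\<^esub> (x \<oplus>\<^bsub>FOUR\<^esub> y) \<in> Tr \<longleftrightarrow> \<^bold>\<not>\<^bsub>FOUR\<^esub> x \<in> Tr \<or> \<^bold>\<not>\<^bsub>FOUR\<^esub> y \<in> Tr"
  by (cases x rule: val_cases; cases y rule: val_cases; simp)+

section \<open>Assignments, entailment and filters\<close>

text \<open>Since \<open>Fm\<close> is absolutely free, its homomorphisms are exactly the extensions
  of assignments, which may replace them throughout.\<close>

primrec interp :: "'a alg \<Rightarrow> (nat \<Rightarrow> 'a) \<Rightarrow> fm \<Rightarrow> 'a" where
  "interp A f (Var n) = f n"
| "interp A f (And p q) = interp A f p \<^bold>\<and>\<^bsub>A\<^esub> interp A f q"
| "interp A f (Or p q) = interp A f p \<^bold>\<or>\<^bsub>A\<^esub> interp A f q"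
| "interp A f (Otimes p q) = interp A f p \<otimes>\<^bsub>A\<^esub> interp A f q"
| "interp A f (Oplus p q) = interp A f p \<oplus>\<^bsub>A\<^esub> interp A f q"
| "interp A f (Neg p) = \<^bold>\<not>\<^bsub>A\<^esub> interp A f p"

lemma interp_closed: "algebra A \<Longrightarrow> range f \<subseteq> carrier A \<Longrightarrow> interp A f p \<in> carrier A"
  by (induction p) (auto simp: algebra_def)

lemma interp_hom: "algebra A \<Longrightarrow> range f \<subseteq> carrier A \<Longrightarrow> homomorphism Fm A (interp A f)"
  by (simp add: homomorphism_def Fm_def interp_closed)

lemma hom_interp:
  assumes "algebra A" "homomorphism A B h" "range f \<subseteq> carrier A"
  shows "h (interp A f p) = interp B (h \<circ> f) p"
  using assms interp_closed[OF assms(1,3)] by (induction p) (simp_all add: homomorphism_def)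

lemma hom_eq_interp:
  assumes "homomorphism Fm A h"
  shows "h p = interp A (h \<circ> Var) p"
  using assms by (induction p) (simp_all add: homomorphism_def Fm_def)

lemma interp_interp: "interp A f (interp Fm s p) = interp A (\<lambda>n. interp A f (s n)) p"
  by (induction p) (simp_all add: Fm_def)

lemma LB_entails_iff:
  "LB_entails \<Gamma> \<phi> \<longleftrightarrow> (\<forall>v. (\<forall>\<gamma>\<in>\<Gamma>. interp FOUR v \<gamma> \<in> Tr) \<longrightarrow> interp FOUR v \<phi> \<in> Tr)"
  (is "?L \<longleftrightarrow> ?R")
proof
  have "algebra FOUR" by (simp add: algebra_def)
  then have "homomorphism Fm FOUR (interp FOUR v)" for v by (simp add: interp_hom)
  then show "?L \<Longrightarrow> ?R" unfolding LB_entails_def by (metis image_subsetI)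
next
  assume R: ?R
  show ?L
    unfolding LB_entails_def
  proof (intro allI impI)
    fix h assume "homomorphism Fm FOUR h" "h ` \<Gamma> \<subseteq> Tr"
    moreover from this(1) have "h p = interp FOUR (h \<circ> Var) p" for p
      by (rule hom_eq_interp)
    ultimately show "h \<phi> \<in> Tr" using R by (metis image_subset_iff)
  qed
qed

lemma LB_filterI:
  assumes "F \<subseteq> carrier A"
    and "\<And>\<Gamma> \<phi> f. LB_entails \<Gamma> \<phi> \<Longrightarrow> range f \<subseteq> carrier A \<Longrightarrow>
      \<forall>\<gamma>\<in>\<Gamma>. interp A f \<gamma> \<in> F \<Longrightarrow> interp A f \<phi> \<in> F"
  shows "LB_filter A F"
  unfolding LB_filter_def
proof (intro conjI allI impI)
  fix \<Gamma> \<phi> h assume *: "LB_entails \<Gamma> \<phi>" "homomorphism Fm A h" "h ` \<Gamma> \<subseteq> F"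
  have h: "h p = interp A (h \<circ> Var) p" for p by (rule hom_eq_interp[OF *(2)])
  have "range (h \<circ> Var) \<subseteq> carrier A" using *(2) by (auto simp: homomorphism_def Fm_def)
  moreover have "\<forall>\<gamma>\<in>\<Gamma>. interp A (h \<circ> Var) \<gamma> \<in> F" using *(3) h by (metis image_subset_iff)
  ultimately show "h \<phi> \<in> F" using assms(2)[OF *(1)] h by metis
qed (rule assms(1))

lemma LB_filterD:
  assumes "LB_filter A F" "algebra A" "range f \<subseteq> carrier A" "LB_entails \<Gamma> \<phi>"
    "\<And>\<gamma>. \<gamma> \<in> \<Gamma> \<Longrightarrow> interp A f \<gamma> \<in> F"
  shows "interp A f \<phi> \<in> F"
  using assms interp_hom[OF assms(2,3)] unfolding LB_filter_def by (meson image_subsetI)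

text \<open>An assignment into \<open>B\<close> lifts through the surjection by choosing preimages
  of the values of the variables, and one into \<open>A\<close> is pushed forward by composition.
  The same entailment is then tested on both sides.\<close>

lemma LB_filter_vimage_iff:
  assumes alg: "algebra A" and h: "homomorphism A B h" "h ` carrier A = carrier B"
    and Y: "Y \<subseteq> carrier B"
  shows "LB_filter A {a \<in> carrier A. h a \<in> Y} \<longleftrightarrow> LB_filter B Y" (is "LB_filter A ?Z \<longleftrightarrow> _")
proof
  assume L: "LB_filter A ?Z"
  show "LB_filter B Y"
  proof (rule LB_filterI[OF Y])
    fix \<Gamma> \<phi> and f :: "nat \<Rightarrow> _"
    assume *: "LB_entails \<Gamma> \<phi>" "range f \<subseteq> carrier B" "\<forall>\<gamma>\<in>\<Gamma>. interp B f \<gamma> \<in> Y"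
    define g where "g = inv_into (carrier A) h \<circ> f"
    have g: "range g \<subseteq> carrier A" "h \<circ> g = f"
      using *(2) h(2) by (auto simp: g_def fun_eq_iff inv_into_into f_inv_into_f image_subset_iff)
    have hg: "h (interp A g p) = interp B f p" for p
      using hom_interp[OF alg h(1) g(1)] g(2) by simp
    have "interp A g \<phi> \<in> ?Z"
      by (rule LB_filterD[OF L alg g(1) *(1)]) (use *(3) interp_closed[OF alg g(1)] hg in auto)
    then show "interp B f \<phi> \<in> Y" using hg by simp
  qed
next
  assume L: "LB_filter B Y"
  show "LB_filter A ?Z"
  proof (rule LB_filterI)
    fix \<Gamma> \<phi> and f :: "nat \<Rightarrow> _"
    assume *: "LB_entails \<Gamma> \<phi>" "range f \<subseteq> carrier A" "\<forall>\<gamma>\<in>\<Gamma>. interp A f \<gamma> \<in> ?Z"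
    have "homomorphism Fm B (h \<circ> interp A f)"
      using interp_hom[OF alg *(2)] h(1) by (simp add: homomorphism_def)
    moreover have "(h \<circ> interp A f) ` \<Gamma> \<subseteq> Y" using *(3) by auto
    ultimately have "(h \<circ> interp A f) \<phi> \<in> Y" using L *(1) unfolding LB_filter_def by blast
    then show "interp A f \<phi> \<in> ?Z" using interp_closed[OF alg *(2)] by simp
  qed auto
qed

section \<open>Rules that hold in every filter\<close>

locale filter_on =
  fixes A :: "'a alg" and F
  assumes alg: "algebra A" and filter: "LB_filter A F"
begin

text \<open>With \<open>Var 0\<close> sent to \<open>a\<close> and every other variable to
  \<open>b\<close>, a rule written in \<open>Var 0\<close> and \<open>Var 1\<close> becomes a
  closure property of \<open>F\<close>.\<close>

lemma rule2:
  assumes "a \<in> carrier A" "b \<in> carrier A" "LB_entails \<Gamma> \<phi>"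
    "\<forall>\<gamma>\<in>\<Gamma>. interp A (\<lambda>n. if n = 0 then a else b) \<gamma> \<in> F"
  shows "interp A (\<lambda>n. if n = 0 then a else b) \<phi> \<in> F"
  by (rule LB_filterD[OF filter alg _ assms(3)]) (use assms in auto)

lemma entails_imp:
  assumes "a \<in> carrier A" "b \<in> carrier A"
    and "\<And>v. interp FOUR v \<phi> \<in> Tr \<Longrightarrow> interp FOUR v \<psi> \<in> Tr"
    and "interp A (\<lambda>n. if n = 0 then a else b) \<phi> \<in> F"
  shows "interp A (\<lambda>n. if n = 0 then a else b) \<psi> \<in> F"
  by (rule rule2[OF assms(1,2), of "{\<phi>}"]) (use assms(3,4) in \<open>simp_all add: LB_entails_iff\<close>)

lemma equivalent_iff:
  assumes "a \<in> carrier A" "b \<in> carrier A"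
    and "\<And>v. interp FOUR v \<phi> \<in> Tr \<longleftrightarrow> interp FOUR v \<psi> \<in> Tr"
  shows "interp A (\<lambda>n. if n = 0 then a else b) \<phi> \<in> F \<longleftrightarrow>
    interp A (\<lambda>n. if n = 0 then a else b) \<psi> \<in> F"
  using entails_imp[OF assms(1,2)] assms(3) by blast

lemma land_iff:
  assumes "a \<in> carrier A" "b \<in> carrier A"
  shows "a \<^bold>\<and>\<^bsub>A\<^esub> b \<in> F \<longleftrightarrow> a \<in> F \<and> b \<in> F"
proof -
  have "a \<^bold>\<and>\<^bsub>A\<^esub> b \<in> F" if "a \<in> F" "b \<in> F"
    using rule2[OF assms, of "{Var 0, Var 1}" "And (Var 0) (Var 1)"] that
    by (simp add: LB_entails_iff)
  moreover have "a \<in> F" "b \<in> F" if "a \<^bold>\<and>\<^bsub>A\<^esub> b \<in> F"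
    using entails_imp[OF assms, of "And (Var 0) (Var 1)" "Var 0"]
      entails_imp[OF assms, of "And (Var 0) (Var 1)" "Var 1"] that by simp_all
  ultimately show ?thesis by blast
qed

lemma otimes_iff:
  assumes "a \<in> carrier A" "b \<in> carrier A"
  shows "a \<otimes>\<^bsub>A\<^esub> b \<in> F \<longleftrightarrow> a \<in> F \<and> b \<in> F"
  using equivalent_iff[OF assms, of "Otimes (Var 0) (Var 1)" "And (Var 0) (Var 1)"] land_iff[OF assms]
  by simp

lemma oplus_iff:
  assumes "a \<in> carrier A" "b \<in> carrier A"
  shows "a \<oplus>\<^bsub>A\<^esub> b \<in> F \<longleftrightarrow> a \<^bold>\<or>\<^bsub>A\<^esub> b \<in> F"
  using equivalent_iff[OF assms, of "Oplus (Var 0) (Var 1)" "Or (Var 0) (Var 1)"] by simp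

lemma lor_comm:
  assumes "a \<in> carrier A" "b \<in> carrier A" "a \<^bold>\<or>\<^bsub>A\<^esub> b \<in> F"
  shows "b \<^bold>\<or>\<^bsub>A\<^esub> a \<in> F"
  using entails_imp[OF assms(1,2), of "Or (Var 0) (Var 1)" "Or (Var 1) (Var 0)"] assms(3)
  by (simp add: disj_commute)

lemma lorI1:
  assumes "a \<in> carrier A" "b \<in> carrier A" "a \<in> F"
  shows "a \<^bold>\<or>\<^bsub>A\<^esub> b \<in> F"
  using entails_imp[OF assms(1,2), of "Var 0" "Or (Var 0) (Var 1)"] assms(3) by simp

lemma lor_idem:
  assumes "a \<in> carrier A"
  shows "a \<^bold>\<or>\<^bsub>A\<^esub> a \<in> F \<longleftrightarrow> a \<in> F"
  using equivalent_iff[OF assms assms, of "Or (Var 0) (Var 0)" "Var 0"] by simp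

lemma lneg_lneg_iff:
  assumes "a \<in> carrier A"
  shows "\<^bold>\<not>\<^bsub>A\<^esub> (\<^bold>\<not>\<^bsub>A\<^esub> a) \<in> F \<longleftrightarrow> a \<in> F"
  using equivalent_iff[OF assms assms, of "Neg (Neg (Var 0))" "Var 0"] by simp

lemma de_morgan_iff:
  assumes "a \<in> carrier A" "b \<in> carrier A"
  shows "\<^bold>\<not>\<^bsub>A\<^esub> (a \<^bold>\<and>\<^bsub>A\<^esub> b) \<in> F \<longleftrightarrow> (\<^bold>\<not>\<^bsub>A\<^esub> a) \<^bold>\<or>\<^bsub>A\<^esub> (\<^bold>\<not>\<^bsub>A\<^esub> b) \<in> F"
    "\<^bold>\<not>\<^bsub>A\<^esub> (a \<^bold>\<or>\<^bsub>A\<^esub> b) \<in> F \<longleftrightarrow> (\<^bold>\<not>\<^bsub>A\<^esub> a) \<^bold>\<and>\<^bsub>A\<^esub> (\<^bold>\<not>\<^bsub>A\<^esub> b) \<in> F"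
    "\<^bold>\<not>\<^bsub>A\<^esub> (a \<otimes>\<^bsub>A\<^esub> b) \<in> F \<longleftrightarrow> (\<^bold>\<not>\<^bsub>A\<^esub> a) \<otimes>\<^bsub>A\<^esub> (\<^bold>\<not>\<^bsub>A\<^esub> b) \<in> F"
    "\<^bold>\<not>\<^bsub>A\<^esub> (a \<oplus>\<^bsub>A\<^esub> b) \<in> F \<longleftrightarrow> (\<^bold>\<not>\<^bsub>A\<^esub> a) \<oplus>\<^bsub>A\<^esub> (\<^bold>\<not>\<^bsub>A\<^esub> b) \<in> F"
  using equivalent_iff[OF assms, of "Neg (And (Var 0) (Var 1))" "Or (Neg (Var 0)) (Neg (Var 1))"]
    equivalent_iff[OF assms, of "Neg (Or (Var 0) (Var 1))" "And (Neg (Var 0)) (Neg (Var 1))"]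
    equivalent_iff[OF assms, of "Neg (Otimes (Var 0) (Var 1))" "Otimes (Neg (Var 0)) (Neg (Var 1))"]
    equivalent_iff[OF assms, of "Neg (Oplus (Var 0) (Var 1))" "Oplus (Neg (Var 0)) (Neg (Var 1))"]
  by simp_all

text \<open>The parameter \<open>c\<close> becomes the value of \<open>Var 0\<close> after shifting all variables, since a
  premise set may use all of them.\<close>

lemma residual_filter:
  assumes c: "c \<in> carrier A"
  shows "LB_filter A {x \<in> carrier A. x \<^bold>\<or>\<^bsub>A\<^esub> c \<in> F}"
proof (rule LB_filterI)
  fix \<Gamma> \<phi> and f :: "nat \<Rightarrow> 'a"
  assume *: "LB_entails \<Gamma> \<phi>" "range f \<subseteq> carrier A"
    "\<forall>\<gamma>\<in>\<Gamma>. interp A f \<gamma> \<in> {x \<in> carrier A. x \<^bold>\<or>\<^bsub>A\<^esub> c \<in> F}"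
  define s where "s p = Or (interp Fm (\<lambda>n. Var (Suc n)) p) (Var 0)" for p
  define g where "g = case_nat c f"
  have g: "range g \<subseteq> carrier A" using *(2) c by (auto simp: g_def image_subset_iff split: nat.split)
  have s: "interp A g (s p) = interp A f p \<^bold>\<or>\<^bsub>A\<^esub> c" for p
    by (simp add: s_def interp_interp g_def)
  \<comment> \<open>Disjoining one formula to all premises and to the conclusion keeps an entailment
    valid because \<open>Tr\<close> is prime: either \<open>Var 0\<close> is designated, or all
    shifted premises are.\<close>
  have "LB_entails (s ` \<Gamma>) (s \<phi>)"
    using *(1) by (auto simp: LB_entails_iff s_def interp_interp)
  then have "interp A g (s \<phi>) \<in> F"
    by (rule LB_filterD[OF filter alg g]) (use *(3) s in auto)
  then show "interp A f \<phi> \<in> {x \<in> carrier A. x \<^bold>\<or>\<^bsub>A\<^esub> c \<in> F}"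
    using s interp_closed[OF alg *(2)] by simp
qed auto

end

text \<open>\<open>{Bot}\<close> is a subalgebra of \<open>FOUR\<close>, so the assignment with
  constant value \<open>Bot\<close> designates no formula. Every valid entailment thus has a
  premise, and the empty set cannot satisfy it.\<close>

lemma LB_filter_empty: "LB_filter A {}"
proof (rule LB_filterI)
  fix \<Gamma> \<phi> and f :: "nat \<Rightarrow> _"
  assume *: "LB_entails \<Gamma> \<phi>" "\<forall>\<gamma>\<in>\<Gamma>. interp A f \<gamma> \<in> {}"
  have "interp FOUR (\<lambda>_. val False False) p = val False False" for p
    by (induction p) simp_all
  then show "interp A f \<phi> \<in> {}"
    using * by (simp add: LB_entails_iff) (metis val_in_Tr)
qed simp

text \<open>The conditions of the theorem, arranged as rewrite rules that carry each closure
  directly to its intended value.\<close>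

definition LB_properties :: "'a alg \<Rightarrow> ('a set \<Rightarrow> 'a set) \<Rightarrow> bool" where
  "LB_properties A C \<longleftrightarrow>
    C {} = {} \<and>
    (\<forall>a \<in> carrier A. \<forall>b \<in> carrier A. C {a \<^bold>\<and>\<^bsub>A\<^esub> b} = C {a, b} \<and> C {a \<otimes>\<^bsub>A\<^esub> b} = C {a, b}) \<and>
    (\<forall>X a b. X \<subseteq> carrier A \<longrightarrow> a \<in> carrier A \<longrightarrow> b \<in> carrier A \<longrightarrow>
       C (insert (a \<^bold>\<or>\<^bsub>A\<^esub> b) X) = C (insert a X) \<inter> C (insert b X) \<and>
       C (insert (a \<oplus>\<^bsub>A\<^esub> b) X) = C (insert a X) \<inter> C (insert b X)) \<and>
    (\<forall>a \<in> carrier A. C {\<^bold>\<not>\<^bsub>A\<^esub> (\<^bold>\<not>\<^bsub>A\<^esub> a)} = C {a}) \<and>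
    (\<forall>a \<in> carrier A. \<forall>b \<in> carrier A.
       C {\<^bold>\<not>\<^bsub>A\<^esub> (a \<^bold>\<and>\<^bsub>A\<^esub> b)} = C {(\<^bold>\<not>\<^bsub>A\<^esub> a) \<^bold>\<or>\<^bsub>A\<^esub> (\<^bold>\<not>\<^bsub>A\<^esub> b)} \<and>
       C {\<^bold>\<not>\<^bsub>A\<^esub> (a \<^bold>\<or>\<^bsub>A\<^esub> b)} = C {(\<^bold>\<not>\<^bsub>A\<^esub> a) \<^bold>\<and>\<^bsub>A\<^esub> (\<^bold>\<not>\<^bsub>A\<^esub> b)} \<and>
       C {\<^bold>\<not>\<^bsub>A\<^esub> (a \<otimes>\<^bsub>A\<^esub> b)} = C {(\<^bold>\<not>\<^bsub>A\<^esub> a) \<otimes>\<^bsub>A\<^esub> (\<^bold>\<not>\<^bsub>A\<^esub> b)} \<and>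
       C {\<^bold>\<not>\<^bsub>A\<^esub> (a \<oplus>\<^bsub>A\<^esub> b)} = C {(\<^bold>\<not>\<^bsub>A\<^esub> a) \<oplus>\<^bsub>A\<^esub> (\<^bold>\<not>\<^bsub>A\<^esub> b)})"

section \<open>Closure operators on an algebra\<close>

locale abs_logic =
  fixes A :: "'a alg" and C :: "'a set \<Rightarrow> 'a set"
  assumes abs: "abstract_logic A C"
begin

lemma alg: "algebra A"
  using abs by (simp add: abstract_logic_def)

lemma op_closed [simp]:
  "a \<in> carrier A \<Longrightarrow> \<^bold>\<not>\<^bsub>A\<^esub> a \<in> carrier A"
  "a \<in> carrier A \<Longrightarrow> b \<in> carrier A \<Longrightarrow> a \<^bold>\<and>\<^bsub>A\<^esub> b \<in> carrier A"
  "a \<in> carrier A \<Longrightarrow> b \<in> carrier A \<Longrightarrow> a \<^bold>\<or>\<^bsub>A\<^esub> b \<in> carrier A"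
  "a \<in> carrier A \<Longrightarrow> b \<in> carrier A \<Longrightarrow> a \<otimes>\<^bsub>A\<^esub> b \<in> carrier A"
  "a \<in> carrier A \<Longrightarrow> b \<in> carrier A \<Longrightarrow> a \<oplus>\<^bsub>A\<^esub> b \<in> carrier A"
  using alg by (simp_all add: algebra_def)

lemma
  assumes "X \<subseteq> carrier A"
  shows C_carrier: "C X \<subseteq> carrier A" and C_ext: "X \<subseteq> C X" and C_idem: "C (C X) = C X"
  using abs assms by (auto simp: abstract_logic_def closure_operator_on_def)

lemma C_mono: "X \<subseteq> Y \<Longrightarrow> Y \<subseteq> carrier A \<Longrightarrow> C X \<subseteq> C Y"
  using abs by (auto simp: abstract_logic_def closure_operator_on_def)

lemma C_least: "X \<subseteq> C Y \<Longrightarrow> Y \<subseteq> carrier A \<Longrightarrow> C X \<subseteq> C Y"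
  by (metis C_mono C_carrier C_idem)

lemma C_subset_closed_iff:
  assumes "X \<subseteq> carrier A" "P \<subseteq> carrier A" "C P = P"
  shows "C X \<subseteq> P \<longleftrightarrow> X \<subseteq> P"
  by (metis assms C_ext C_mono subset_trans)

text \<open>This evaluates the operations of the quotient \<open>B\<close> below, which join closed
  sets, in terms of generators.\<close>

lemma C_Un_C:
  assumes "X \<subseteq> carrier A" "Y \<subseteq> carrier A"
  shows "C (C X \<union> C Y) = C (X \<union> Y)"
proof
  have "C X \<subseteq> C (X \<union> Y)" "C Y \<subseteq> C (X \<union> Y)" using assms by (simp_all add: C_mono)
  then show "C (C X \<union> C Y) \<subseteq> C (X \<union> Y)" using assms by (intro C_least) auto
  show "C (X \<union> Y) \<subseteq> C (C X \<union> C Y)"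
    using assms C_ext C_carrier by (intro C_mono) blast+
qed

end

section \<open>Separation by prime closed sets\<close>

locale LB_logic = abs_logic +
  assumes fin: "finitary A C" and props: "LB_properties A C"
begin

lemma C_empty: "C {} = {}"
  using props by (simp add: LB_properties_def)

lemma
  assumes "a \<in> carrier A" "b \<in> carrier A"
  shows C_land: "C {a \<^bold>\<and>\<^bsub>A\<^esub> b} = C {a, b}"
    and C_otimes: "C {a \<otimes>\<^bsub>A\<^esub> b} = C {a, b}"
  using props assms by (auto simp: LB_properties_def)

lemma C_lor_insert:
  assumes "X \<subseteq> carrier A" "a \<in> carrier A" "b \<in> carrier A"
  shows "C (insert (a \<^bold>\<or>\<^bsub>A\<^esub> b) X) = C (insert a X) \<inter> C (insert b X)"
  using props assms by (simp add: LB_properties_def)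

lemma
  assumes "a \<in> carrier A" "b \<in> carrier A"
  shows C_lor: "C {a \<^bold>\<or>\<^bsub>A\<^esub> b} = C {a} \<inter> C {b}"
    and C_oplus: "C {a \<oplus>\<^bsub>A\<^esub> b} = C {a} \<inter> C {b}"
  using props assms by (auto simp: LB_properties_def)

lemma C_lneg_lneg: "a \<in> carrier A \<Longrightarrow> C {\<^bold>\<not>\<^bsub>A\<^esub> (\<^bold>\<not>\<^bsub>A\<^esub> a)} = C {a}"
  using props by (simp add: LB_properties_def)

text \<open>Each De Morgan law is followed by (PC) or (PDI) without side premises, so the closure of
  a negated compound depends only on the closures of the negated components.\<close>

lemma C_lneg:
  assumes "a \<in> carrier A" "b \<in> carrier A"
  shows "C {\<^bold>\<not>\<^bsub>A\<^esub> (a \<^bold>\<and>\<^bsub>A\<^esub> b)} = C {\<^bold>\<not>\<^bsub>A\<^esub> a} \<inter> C {\<^bold>\<not>\<^bsub>A\<^esub> b}"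
    "C {\<^bold>\<not>\<^bsub>A\<^esub> (a \<^bold>\<or>\<^bsub>A\<^esub> b)} = C {\<^bold>\<not>\<^bsub>A\<^esub> a, \<^bold>\<not>\<^bsub>A\<^esub> b}"
    "C {\<^bold>\<not>\<^bsub>A\<^esub> (a \<otimes>\<^bsub>A\<^esub> b)} = C {\<^bold>\<not>\<^bsub>A\<^esub> a, \<^bold>\<not>\<^bsub>A\<^esub> b}"
    "C {\<^bold>\<not>\<^bsub>A\<^esub> (a \<oplus>\<^bsub>A\<^esub> b)} = C {\<^bold>\<not>\<^bsub>A\<^esub> a} \<inter> C {\<^bold>\<not>\<^bsub>A\<^esub> b}"
  using props assms by (simp_all add: LB_properties_def)

lemma finitaryE:
  assumes "a \<in> C X" "X \<subseteq> carrier A"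
  obtains X0 where "X0 \<subseteq> X" "finite X0" "a \<in> C X0"
  using fin assms unfolding finitary_def by metis

text \<open>Among the closed sets that contain \<open>T\<close> and omit \<open>x\<close> there is a
  maximal one, because finitarity makes unions of nonempty chains closed. Adding any further element
  to it makes \<open>x\<close> derivable, so by (PDI) it is prime.\<close>

lemma prime_separation:
  assumes T: "T \<subseteq> carrier A" "C T = T" "x \<notin> T" and x: "x \<in> carrier A"
  obtains P where "P \<subseteq> carrier A" "C P = P" "T \<subseteq> P" "x \<notin> P"
    "\<And>a b. a \<in> carrier A \<Longrightarrow> b \<in> carrier A \<Longrightarrow> a \<^bold>\<or>\<^bsub>A\<^esub> b \<in> P \<Longrightarrow> a \<in> P \<or> b \<in> P"
proof -
  define S where "S = {P. P \<subseteq> carrier A \<and> C P = P \<and> T \<subseteq> P \<and> x \<notin> P}"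
  have "\<exists>P\<in>S. \<forall>Q\<in>S. P \<subseteq> Q \<longrightarrow> Q = P"
  proof (rule subset_Zorn_nonempty)
    show "S \<noteq> {}" using T by (auto simp: S_def)
    fix K assume K: "K \<noteq> {}" "subset.chain S K"
    then have KS: "K \<subseteq> S" by (simp add: subset.chain_def)
    have sub: "\<Union>K \<subseteq> carrier A" using KS by (auto simp: S_def)
    have "a \<in> \<Union>K" if a: "a \<in> C (\<Union>K)" for a
    proof -
      obtain X0 where X0: "X0 \<subseteq> \<Union>K" "finite X0" "a \<in> C X0"
        using finitaryE[OF a sub] .
      obtain P where P: "P \<in> K" "X0 \<subseteq> P"
        using finite_subset_Union_chain[OF X0(2,1) K] by blast
      moreover have "P \<subseteq> carrier A" "C P = P" using P(1) KS by (auto simp: S_def)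
      ultimately have "C X0 \<subseteq> P" using C_mono[of X0 P] by simp
      then show ?thesis using P X0(3) by blast
    qed
    then have "C (\<Union>K) = \<Union>K" using C_ext[OF sub] by blast
    moreover have "T \<subseteq> \<Union>K"
    proof -
      obtain Q where "Q \<in> K" using K(1) by blast
      moreover from this have "T \<subseteq> Q" using KS by (auto simp: S_def)
      ultimately show ?thesis by (meson Union_upper subset_trans)
    qed
    moreover have "x \<notin> \<Union>K" using KS by (auto simp: S_def)
    ultimately show "\<Union>K \<in> S" using sub by (simp add: S_def)
  qed
  then obtain P where "P \<in> S" and max: "\<And>Q. Q \<in> S \<Longrightarrow> P \<subseteq> Q \<Longrightarrow> Q = P"
    by metis
  then have P: "P \<subseteq> carrier A" "C P = P" "T \<subseteq> P" "x \<notin> P" by (simp_all add: S_def)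
  have x_in: "x \<in> C (insert a P)" if a: "a \<in> carrier A" "a \<notin> P" for a
  proof (rule ccontr)
    assume nx: "x \<notin> C (insert a P)"
    have sub: "insert a P \<subseteq> carrier A" using a P by simp
    have "C (insert a P) \<in> S"
      using nx P(3) C_ext[OF sub] C_carrier[OF sub] C_idem[OF sub] by (auto simp: S_def)
    then have "C (insert a P) = P" using max C_ext[OF sub] by blast
    then show False using C_ext[OF sub] a by blast
  qed
  have prime: "a \<in> P \<or> b \<in> P"
    if "a \<in> carrier A" "b \<in> carrier A" "a \<^bold>\<or>\<^bsub>A\<^esub> b \<in> P" for a b
  proof (rule ccontr)
    assume "\<not> ?thesis"
    then have "x \<in> C (insert (a \<^bold>\<or>\<^bsub>A\<^esub> b) P)"
      using x_in[OF that(1)] x_in[OF that(2)] by (simp add: C_lor_insert[OF P(1) that(1,2)])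
    then show False using that(3) P by (simp add: insert_absorb)
  qed
  show thesis by (rule that[OF P prime])
qed

text \<open>Membership in a closed \<open>P\<close> depends only on the closure of the element, so
  (PC) settles conjunctions and (PDI) with primeness settles disjunctions in the first bit. The De
  Morgan laws do the same for the second bit, and (PDN) handles negation.\<close>

lemma prime_hom:
  assumes P: "P \<subseteq> carrier A" "C P = P"
    and prime: "\<And>a b. a \<in> carrier A \<Longrightarrow> b \<in> carrier A \<Longrightarrow> a \<^bold>\<or>\<^bsub>A\<^esub> b \<in> P \<Longrightarrow> a \<in> P \<or> b \<in> P"
  shows "homomorphism A FOUR (\<lambda>x. val (x \<in> P) (\<^bold>\<not>\<^bsub>A\<^esub> x \<in> P))"
proof -
  have iff: "x \<in> P \<longleftrightarrow> Y \<subseteq> P" if "C {x} = C Y" "x \<in> carrier A" "Y \<subseteq> carrier A" for x Y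
    using C_subset_closed_iff[of "{x}", OF _ P] C_subset_closed_iff[of Y, OF _ P] that by simp
  have join: "z \<in> P \<longleftrightarrow> a \<in> P \<or> b \<in> P"
    if "C {z} = C {a} \<inter> C {b}" "z \<in> carrier A" "a \<in> carrier A" "b \<in> carrier A" for z a b
  proof -
    have "z \<in> P \<longleftrightarrow> a \<^bold>\<or>\<^bsub>A\<^esub> b \<in> P"
      using iff[of z "{a \<^bold>\<or>\<^bsub>A\<^esub> b}"] that C_lor[of a b] by simp
    moreover have "a \<^bold>\<or>\<^bsub>A\<^esub> b \<in> C {a}" "a \<^bold>\<or>\<^bsub>A\<^esub> b \<in> C {b}"
      using C_ext[of "{a \<^bold>\<or>\<^bsub>A\<^esub> b}"] C_lor[of a b] that by auto
    ultimately show ?thesis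
      using prime[of a b] that C_subset_closed_iff[of "{a}", OF _ P]
        C_subset_closed_iff[of "{b}", OF _ P] by auto
  qed
  show ?thesis
    by (simp add: homomorphism_def iff[OF C_land] iff[OF C_otimes] join[OF C_lor] join[OF C_oplus]
        iff[OF C_lneg_lneg] join[OF C_lneg(1)] iff[OF C_lneg(2)] iff[OF C_lneg(3)]
        join[OF C_lneg(4)])
qed

lemma closed_is_filter:
  assumes T: "T \<subseteq> carrier A" "C T = T"
  shows "LB_filter A T"
proof (rule LB_filterI[OF T(1)])
  fix \<Gamma> \<phi> and f :: "nat \<Rightarrow> 'a"
  assume *: "LB_entails \<Gamma> \<phi>" "range f \<subseteq> carrier A" "\<forall>\<gamma>\<in>\<Gamma>. interp A f \<gamma> \<in> T"
  show "interp A f \<phi> \<in> T"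
  proof (rule ccontr)
    assume "interp A f \<phi> \<notin> T"
    then obtain P where P: "P \<subseteq> carrier A" "C P = P" "T \<subseteq> P" "interp A f \<phi> \<notin> P"
      "\<And>a b. a \<in> carrier A \<Longrightarrow> b \<in> carrier A \<Longrightarrow> a \<^bold>\<or>\<^bsub>A\<^esub> b \<in> P \<Longrightarrow> a \<in> P \<or> b \<in> P"
      using prime_separation[OF T _ interp_closed[OF alg *(2)]] by blast
    let ?v = "\<lambda>x. val (x \<in> P) (\<^bold>\<not>\<^bsub>A\<^esub> x \<in> P)"
    \<comment> \<open>Composing \<open>f\<close> with \<open>?v\<close> gives an assignment into
      \<open>FOUR\<close> that designates exactly the formulas with value in \<open>P\<close>, so it
      satisfies \<open>\<Gamma>\<close> and refutes \<open>\<phi>\<close>.\<close>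
    have "?v (interp A f p) = interp FOUR (?v \<circ> f) p" for p
      by (rule hom_interp[OF alg prime_hom[OF P(1,2,5)] *(2)])
    then have "interp FOUR (?v \<circ> f) p \<in> Tr \<longleftrightarrow> interp A f p \<in> P" for p
      by (metis val_in_Tr)
    then show False using * P(3,4) unfolding LB_entails_iff by blast
  qed
qed

end

section \<open>The finitary part of a closure operator\<close>

text \<open>For a closure operator \<open>C\<close> this is the largest finitary closure operator
  below \<open>C\<close>.\<close>

definition finitary_part :: "('a set \<Rightarrow> 'a set) \<Rightarrow> 'a set \<Rightarrow> 'a set" where
  "finitary_part C X = (\<Union>X0\<in>{X0. X0 \<subseteq> X \<and> finite X0}. C X0)"

context abs_logic
begin

lemma finitary_part_finite:
  assumes "finite X" "X \<subseteq> carrier A"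
  shows "finitary_part C X = C X"
  using assms C_mono[OF _ assms(2)] by (auto simp: finitary_part_def)

lemma finitary_part_subset: "X \<subseteq> carrier A \<Longrightarrow> finitary_part C X \<subseteq> C X"
  unfolding finitary_part_def by (intro UN_least C_mono) auto

lemma finitary_part_mono: "X \<subseteq> Y \<Longrightarrow> finitary_part C X \<subseteq> finitary_part C Y"
  by (auto simp: finitary_part_def)

text \<open>Finitely many elements need finitely many finite witness sets, whose union is still
  finite. Idempotence of the finitary part rests on this.\<close>

lemma finite_subset_finitary_part:
  assumes X: "X \<subseteq> carrier A" and Y: "finite Y" "Y \<subseteq> finitary_part C X"
  obtains X0 where "finite X0" "X0 \<subseteq> X" "Y \<subseteq> C X0"
proof -
  from Y(2) have "\<forall>y\<in>Y. \<exists>X0. X0 \<subseteq> X \<and> finite X0 \<and> y \<in> C X0"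
    by (auto simp: finitary_part_def)
  then obtain S where S: "\<And>y. y \<in> Y \<Longrightarrow> S y \<subseteq> X \<and> finite (S y) \<and> y \<in> C (S y)"
    by metis
  have "Y \<subseteq> C (\<Union>y\<in>Y. S y)"
  proof
    fix y assume y: "y \<in> Y"
    have "C (S y) \<subseteq> C (\<Union>y\<in>Y. S y)" using S X y by (intro C_mono) blast+
    then show "y \<in> C (\<Union>y\<in>Y. S y)" using S y by blast
  qed
  moreover have "finite (\<Union>y\<in>Y. S y)" "(\<Union>y\<in>Y. S y) \<subseteq> X" using Y(1) S by auto
  ultimately show thesis using that by blast
qed

lemma abstract_logic_finitary_part: "abstract_logic A (finitary_part C)"
  unfolding abstract_logic_def closure_operator_on_def
proof (intro conjI allI impI alg)
  fix X assume X: "X \<subseteq> carrier A"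
  show "finitary_part C X \<subseteq> carrier A" using finitary_part_subset[OF X] C_carrier[OF X] by blast
  show ext: "X \<subseteq> finitary_part C X"
  proof
    fix x assume "x \<in> X"
    then have "x \<in> C {x}" using C_ext[of "{x}"] X by auto
    then show "x \<in> finitary_part C X"
      using \<open>x \<in> X\<close> by (auto simp: finitary_part_def intro!: exI[of _ "{x}"])
  qed
  show "finitary_part C (finitary_part C X) = finitary_part C X"
  proof
    show "finitary_part C (finitary_part C X) \<subseteq> finitary_part C X"
    proof
      fix z assume "z \<in> finitary_part C (finitary_part C X)"
      then obtain Y where Y: "finite Y" "Y \<subseteq> finitary_part C X" "z \<in> C Y"
        by (auto simp: finitary_part_def)
      obtain X0 where X0: "finite X0" "X0 \<subseteq> X" "Y \<subseteq> C X0"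
        using finite_subset_finitary_part[OF X Y(1,2)] .
      have "C Y \<subseteq> C X0" using X0 X by (intro C_least) auto
      then show "z \<in> finitary_part C X" using Y(3) X0 by (auto simp: finitary_part_def)
    qed
  qed (rule finitary_part_mono[OF ext])
qed (rule finitary_part_mono)

lemma finitary_finitary_part: "finitary A (finitary_part C)"
  unfolding finitary_def
proof (intro allI impI)
  fix X a assume X: "X \<subseteq> carrier A" "a \<in> finitary_part C X"
  then obtain X0 where X0: "X0 \<subseteq> X" "finite X0" "a \<in> C X0"
    by (auto simp: finitary_part_def)
  then have "a \<in> finitary_part C X0" by (auto simp: finitary_part_def)
  then show "\<exists>X0. X0 \<subseteq> X \<and> finite X0 \<and> a \<in> finitary_part C X0" using X0 by blast
qed

text \<open>By monotonicity a finite witness may be enlarged by \<open>a\<close>, which brings it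
  into the form to which (PDI) applies.\<close>

lemma finitary_part_insert:
  assumes "X \<subseteq> carrier A" "a \<in> carrier A"
  shows "z \<in> finitary_part C (insert a X) \<longleftrightarrow> (\<exists>X0\<subseteq>X. finite X0 \<and> z \<in> C (insert a X0))"
proof
  assume "z \<in> finitary_part C (insert a X)"
  then obtain X0 where X0: "X0 \<subseteq> insert a X" "finite X0" "z \<in> C X0"
    by (auto simp: finitary_part_def)
  have "C X0 \<subseteq> C (insert a (X0 - {a}))" using X0 assms by (intro C_mono) auto
  then show "\<exists>X0\<subseteq>X. finite X0 \<and> z \<in> C (insert a X0)"
    using X0 by (intro exI[of _ "X0 - {a}"]) auto
next
  assume "\<exists>X0\<subseteq>X. finite X0 \<and> z \<in> C (insert a X0)"
  then obtain X0 where "X0 \<subseteq> X" "finite X0" "z \<in> C (insert a X0)" by blast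
  then show "z \<in> finitary_part C (insert a X)"
    by (auto simp: finitary_part_def intro!: exI[of _ "insert a X0"])
qed

text \<open>Only (PDI) involves infinite sets; the other properties apply the operators to finite
  sets, where the two agree.\<close>

lemma LB_properties_finitary_part:
  assumes P: "LB_properties A C"
  shows "LB_properties A (finitary_part C)"
proof -
  have disj: "C (insert c X) = C (insert a X) \<inter> C (insert b X)"
    if "X \<subseteq> carrier A" "a \<in> carrier A" "b \<in> carrier A" "c \<in> {a \<^bold>\<or>\<^bsub>A\<^esub> b, a \<oplus>\<^bsub>A\<^esub> b}" for X a b c
    using that P by (auto simp: LB_properties_def)
  have fin_disj: "finitary_part C (insert c X) =
      finitary_part C (insert a X) \<inter> finitary_part C (insert b X)"
    if X: "X \<subseteq> carrier A" "a \<in> carrier A" "b \<in> carrier A"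
      "c \<in> {a \<^bold>\<or>\<^bsub>A\<^esub> b, a \<oplus>\<^bsub>A\<^esub> b}" for X a b c
  proof -
    have cA: "c \<in> carrier A" using X by auto
    show ?thesis
    proof (intro set_eqI iffI)
      fix z assume "z \<in> finitary_part C (insert c X)"
      then obtain Y where Y: "Y \<subseteq> X" "finite Y" "z \<in> C (insert c Y)"
        using X(1) cA by (auto simp: finitary_part_insert)
      then have "z \<in> C (insert a Y)" "z \<in> C (insert b Y)"
        using X disj[of Y a b c] by auto
      then show "z \<in> finitary_part C (insert a X) \<inter> finitary_part C (insert b X)"
        using X(1-3) Y(1,2) by (auto simp: finitary_part_insert)
    next
      fix z assume "z \<in> finitary_part C (insert a X) \<inter> finitary_part C (insert b X)"
      then obtain Y Z where Y: "Y \<subseteq> X" "finite Y" "z \<in> C (insert a Y)"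
        and Z: "Z \<subseteq> X" "finite Z" "z \<in> C (insert b Z)"
        using X(1-3) by (auto simp: finitary_part_insert)
      \<comment> \<open>The two finite witnesses may differ, so (PDI) for \<open>C\<close> is
        applied to their union, again a finite subset of \<open>X\<close>.\<close>
      have YZ: "Y \<union> Z \<subseteq> X" "Y \<union> Z \<subseteq> carrier A" "finite (Y \<union> Z)" using X(1) Y Z by auto
      have "C (insert a Y) \<subseteq> C (insert a (Y \<union> Z))"
        by (rule C_mono) (use X(2) YZ(2) in auto)
      moreover have "C (insert b Z) \<subseteq> C (insert b (Y \<union> Z))"
        by (rule C_mono) (use X(3) YZ(2) in auto)
      ultimately have "z \<in> C (insert c (Y \<union> Z))"
        using Y(3) Z(3) disj[OF YZ(2) X(2-4)] by blast
      then show "z \<in> finitary_part C (insert c X)"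
        using YZ(1,3) X(1) cA finitary_part_insert by blast
    qed
  qed
  show ?thesis
    using P unfolding LB_properties_def
    by (simp add: finitary_part_finite fin_disj)
qed

end

section \<open>The closure operator of all filters\<close>

locale LB_filter_logic = abs_logic +
  assumes sys: "closure_system (carrier A) C = {F. LB_filter A F}"
begin

lemma C_iff:
  assumes X: "X \<subseteq> carrier A"
  shows "a \<in> C X \<longleftrightarrow> (\<forall>F. LB_filter A F \<longrightarrow> X \<subseteq> F \<longrightarrow> a \<in> F)"
proof -
  have closed: "LB_filter A F \<longleftrightarrow> F \<subseteq> carrier A \<and> C F = F" for F
    using sys by (auto simp: closure_system_def)
  have "LB_filter A (C X)" using X by (simp add: closed C_carrier C_idem)
  then show ?thesis
    using C_ext[OF X] C_mono[of X] closed by blast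
qed

lemma C_cong:
  assumes "\<And>F. LB_filter A F \<Longrightarrow> X \<subseteq> F \<longleftrightarrow> Y \<subseteq> F" "X \<subseteq> carrier A" "Y \<subseteq> carrier A"
  shows "C X = C Y"
  using assms(1) by (intro set_eqI) (metis C_iff assms(2,3))

lemma filter_on: "LB_filter A F \<Longrightarrow> filter_on A F"
  by (simp add: filter_on_def alg)

text \<open>One inclusion is disjunction introduction in filters. The other is reasoning by cases,
  with residual filters used to replace one disjunct at a time.\<close>

lemma C_lor:
  assumes X: "X \<subseteq> carrier A" "a \<in> carrier A" "b \<in> carrier A"
  shows "C (insert (a \<^bold>\<or>\<^bsub>A\<^esub> b) X) = C (insert a X) \<inter> C (insert b X)"
proof (intro set_eqI iffI)
  fix z assume "z \<in> C (insert (a \<^bold>\<or>\<^bsub>A\<^esub> b) X)"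
  then show "z \<in> C (insert a X) \<inter> C (insert b X)"
    using X filter_on.lorI1[OF filter_on] filter_on.lor_comm[OF filter_on] by (simp add: C_iff)
next
  fix z assume z: "z \<in> C (insert a X) \<inter> C (insert b X)"
  then have zA: "z \<in> carrier A" using C_carrier[of "insert a X"] X by auto
  have "z \<in> F" if F: "LB_filter A F" "insert (a \<^bold>\<or>\<^bsub>A\<^esub> b) X \<subseteq> F" for F
  proof -
    interpret filter_on A F using filter_on[OF F(1)] .
    \<comment> \<open>The residual filter for \<open>c\<close> contains \<open>X\<close> by
      disjunction introduction and \<open>d\<close> by assumption, hence also
      \<open>z\<close>.\<close>
    have res: "z \<^bold>\<or>\<^bsub>A\<^esub> c \<in> F" if c: "c \<in> carrier A" "d \<in> {a, b}" "d \<^bold>\<or>\<^bsub>A\<^esub> c \<in> F" for c d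
    proof -
      have "insert d X \<subseteq> {x \<in> carrier A. x \<^bold>\<or>\<^bsub>A\<^esub> c \<in> F}"
        using c X F(2) lorI1 by auto
      moreover have "z \<in> C (insert d X)" "insert d X \<subseteq> carrier A" using z c(2) X by auto
      ultimately show ?thesis using C_iff residual_filter[OF c(1)] by blast
    qed
    \<comment> \<open>The replacement runs from \<open>a \<or> b\<close> to \<open>z \<or> b\<close>
      and, after commuting, from \<open>b \<or> z\<close> to \<open>z \<or> z\<close>; idempotence
      then yields \<open>z\<close>.\<close>
    have "z \<^bold>\<or>\<^bsub>A\<^esub> b \<in> F" using res[of b a] X F(2) by simp
    then have "z \<^bold>\<or>\<^bsub>A\<^esub> z \<in> F" using res[of z b] lor_comm[OF zA X(3)] zA by simp
    then show ?thesis using lor_idem zA by simp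
  qed
  then show "z \<in> C (insert (a \<^bold>\<or>\<^bsub>A\<^esub> b) X)" using X by (simp add: C_iff)
qed

lemma LB_properties: "LB_properties A C"
proof -
  have oplus: "C (insert (a \<oplus>\<^bsub>A\<^esub> b) X) = C (insert (a \<^bold>\<or>\<^bsub>A\<^esub> b) X)"
    if "X \<subseteq> carrier A" "a \<in> carrier A" "b \<in> carrier A" for X a b
    using that by (intro C_cong) (simp_all add: filter_on[THEN filter_on.oplus_iff])
  have conj: "C {a \<^bold>\<and>\<^bsub>A\<^esub> b} = C {a, b}" "C {a \<otimes>\<^bsub>A\<^esub> b} = C {a, b}"
    if "a \<in> carrier A" "b \<in> carrier A" for a b
    using that by (intro C_cong;
      simp add: filter_on[THEN filter_on.land_iff] filter_on[THEN filter_on.otimes_iff])+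
  have neg: "C {\<^bold>\<not>\<^bsub>A\<^esub> (\<^bold>\<not>\<^bsub>A\<^esub> a)} = C {a}" if "a \<in> carrier A" for a
    using that by (intro C_cong) (simp_all add: filter_on[THEN filter_on.lneg_lneg_iff])
  have de_morgan:
    "C {\<^bold>\<not>\<^bsub>A\<^esub> (a \<^bold>\<and>\<^bsub>A\<^esub> b)} = C {(\<^bold>\<not>\<^bsub>A\<^esub> a) \<^bold>\<or>\<^bsub>A\<^esub> (\<^bold>\<not>\<^bsub>A\<^esub> b)}"
    "C {\<^bold>\<not>\<^bsub>A\<^esub> (a \<^bold>\<or>\<^bsub>A\<^esub> b)} = C {(\<^bold>\<not>\<^bsub>A\<^esub> a) \<^bold>\<and>\<^bsub>A\<^esub> (\<^bold>\<not>\<^bsub>A\<^esub> b)}"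
    "C {\<^bold>\<not>\<^bsub>A\<^esub> (a \<otimes>\<^bsub>A\<^esub> b)} = C {(\<^bold>\<not>\<^bsub>A\<^esub> a) \<otimes>\<^bsub>A\<^esub> (\<^bold>\<not>\<^bsub>A\<^esub> b)}"
    "C {\<^bold>\<not>\<^bsub>A\<^esub> (a \<oplus>\<^bsub>A\<^esub> b)} = C {(\<^bold>\<not>\<^bsub>A\<^esub> a) \<oplus>\<^bsub>A\<^esub> (\<^bold>\<not>\<^bsub>A\<^esub> b)}"
    if "a \<in> carrier A" "b \<in> carrier A" for a b
    using that by (intro C_cong; simp add: filter_on[THEN filter_on.de_morgan_iff(1)]
      filter_on[THEN filter_on.de_morgan_iff(2)] filter_on[THEN filter_on.de_morgan_iff(3)]
      filter_on[THEN filter_on.de_morgan_iff(4)])+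
  have "C {} = {}" using LB_filter_empty C_iff[of "{}"] by blast
  then show ?thesis
    unfolding LB_properties_def by (simp add: conj neg de_morgan oplus C_lor)
qed

text \<open>The finitary part has the same properties, so its closed sets are filters too; hence it
  is not smaller than \<open>C\<close>.\<close>

lemma finitary: "finitary A C"
proof -
  interpret fin: LB_logic A "finitary_part C"
    using abstract_logic_finitary_part finitary_finitary_part
      LB_properties_finitary_part[OF LB_properties] by unfold_locales
  have "C X \<subseteq> finitary_part C X" if X: "X \<subseteq> carrier A" for X
    using fin.closed_is_filter[OF fin.C_carrier fin.C_idem, OF X X] fin.C_ext[OF X] C_iff[OF X]
    by (intro subsetI) simp
  then have "a \<in> finitary_part C X" if "X \<subseteq> carrier A" "a \<in> C X" for X a
    using that by blast
  then show ?thesis by (auto simp: finitary_def finitary_part_def)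
qed

end

section \<open>Transfer along a bilogical morphism\<close>

text \<open>\<open>C X\<close> is the preimage under \<open>h\<close> of the
  \<open>C'\<close>-closure of the image of \<open>X\<close>, so equations between closures on the
  target pull back.\<close>

lemma full_model_properties:
  assumes logic: "abstract_logic A C" and full: "full_model A C"
  shows "finitary A C" "LB_properties A C"
proof -
  interpret src: abs_logic A C by unfold_locales (rule logic)
  obtain A' :: "'a alg" and C' h where via: "full_model_via A C A' C' h"
    using full by (auto simp: full_model_def)
  interpret tgt: LB_filter_logic A' C'
    using via by unfold_locales (auto simp: full_model_via_def)
  have hom: "homomorphism A A' h"
    and bil: "\<And>X a. X \<subseteq> carrier A \<Longrightarrow> a \<in> carrier A \<Longrightarrow> a \<in> C X \<longleftrightarrow> h a \<in> C' (h ` X)"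
    using via by (auto simp: full_model_via_def bilogical_morphism_def)
  have hA: "h a \<in> carrier A'" if "a \<in> carrier A" for a
    using hom that by (simp add: homomorphism_def)
  have C: "C X = {a \<in> carrier A. h a \<in> C' (h ` X)}" if "X \<subseteq> carrier A" for X
    using bil[OF that] src.C_carrier[OF that] by blast
  have P: "LB_properties A' C'" by (rule tgt.LB_properties)
  have hX: "h ` X \<subseteq> carrier A'" if "X \<subseteq> carrier A" for X using that hA by blast
  show "LB_properties A C"
    using P hom unfolding LB_properties_def
    by (auto simp: C hA hX homomorphism_def)
  show "finitary A C"
    unfolding finitary_def
  proof (intro allI impI)
    fix X a assume X: "X \<subseteq> carrier A" and a: "a \<in> C X"
    then have aA: "a \<in> carrier A" "h a \<in> C' (h ` X)" by (auto simp: C)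
    then obtain Y where Y: "Y \<subseteq> h ` X" "finite Y" "h a \<in> C' Y"
      using tgt.finitary hX[OF X] unfolding finitary_def by metis
    \<comment> \<open>One preimage in \<open>X\<close> for each element of \<open>Y\<close> gives a
      finite \<open>X0\<close>.\<close>
    then obtain X0 where X0: "X0 \<subseteq> X" "finite X0" "Y = h ` X0"
      using finite_subset_image by metis
    then show "\<exists>X0. X0 \<subseteq> X \<and> finite X0 \<and> a \<in> C X0"
      using aA Y(3) X bil[of X0 a] by (intro exI[of _ X0]) auto
  qed
qed

section \<open>The quotient on which closed sets and filters coincide\<close>

context LB_logic
begin

text \<open>On \<open>carrier A\<close> the kernel is the largest congruence contained in the
  relation \<open>C {a} = C {b}\<close>.\<close>

definition h :: "'a \<Rightarrow> 'a set \<times> 'a set" where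
  "h a = (C {a}, C {\<^bold>\<not>\<^bsub>A\<^esub> a})"

text \<open>The operations copy \<open>FOUR_val\<close> with closed sets in place of bits:
  conjunction of bits becomes the generated closed set, and disjunction becomes
  intersection.\<close>

definition B :: "('a set \<times> 'a set) alg" where
  "B = \<lparr> carrier = h ` carrier A,
     land = (\<lambda>x y. (C (fst x \<union> fst y), snd x \<inter> snd y)),
     lor = (\<lambda>x y. (fst x \<inter> fst y, C (snd x \<union> snd y))),
     otimes = (\<lambda>x y. (C (fst x \<union> fst y), C (snd x \<union> snd y))),
     oplus = (\<lambda>x y. (fst x \<inter> fst y, snd x \<inter> snd y)),
     lneg = (\<lambda>x. (snd x, fst x)) \<rparr>"

text \<open>This is \<open>C\<close> carried over to the quotient; the full preimage avoids a choice
  of representatives.\<close>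

definition D :: "('a set \<times> 'a set) set \<Rightarrow> ('a set \<times> 'a set) set" where
  "D Y = h ` C {a \<in> carrier A. h a \<in> Y}"

lemma carrier_B: "carrier B = h ` carrier A"
  by (simp add: B_def)

lemma hom_h: "homomorphism A B h"
proof -
  have pair: "C (C {a} \<union> C {b}) = C {a, b}" if "a \<in> carrier A" "b \<in> carrier A" for a b
    using C_Un_C[of "{a}" "{b}"] that by (simp add: insert_commute)
  show ?thesis
    by (simp add: homomorphism_def carrier_B)
      (simp add: B_def h_def pair C_land C_lor C_otimes C_oplus C_lneg C_lneg_lneg)
qed

lemma algebra_B: "algebra B"
proof -
  have "\<^bold>\<not>\<^bsub>B\<^esub> h a = h (\<^bold>\<not>\<^bsub>A\<^esub> a)" "h a \<^bold>\<and>\<^bsub>B\<^esub> h b = h (a \<^bold>\<and>\<^bsub>A\<^esub> b)"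
    "h a \<^bold>\<or>\<^bsub>B\<^esub> h b = h (a \<^bold>\<or>\<^bsub>A\<^esub> b)" "h a \<otimes>\<^bsub>B\<^esub> h b = h (a \<otimes>\<^bsub>A\<^esub> b)"
    "h a \<oplus>\<^bsub>B\<^esub> h b = h (a \<oplus>\<^bsub>A\<^esub> b)"
    if "a \<in> carrier A" "b \<in> carrier A" for a b
    using hom_h that by (simp_all add: homomorphism_def)
  then show ?thesis by (auto simp: algebra_def carrier_B)
qed

text \<open>Equal images force \<open>C {a} = C {b}\<close>, so closed sets are unions of kernel
  classes and survive the passage to the quotient.\<close>

lemma h_eq_imp_mem:
  assumes "h a = h b" "a \<in> carrier A" "b \<in> C X" "X \<subseteq> carrier A"
  shows "a \<in> C X"
proof -
  have "C {b} \<subseteq> C X" using assms by (intro C_least) auto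
  then show ?thesis using assms C_ext[of "{a}"] by (auto simp: h_def)
qed

lemma bilogical_h: "bilogical_morphism A C B D h"
  unfolding bilogical_morphism_def
proof (intro conjI allI impI)
  fix X a assume X: "X \<subseteq> carrier A" and a: "a \<in> carrier A"
  \<comment> \<open>\<open>?Z\<close> adds to \<open>X\<close> everything that \<open>h\<close>
    identifies with an element of \<open>X\<close>. It stays inside \<open>C X\<close>, so its
    closure is the same.\<close>
  let ?Z = "{a \<in> carrier A. h a \<in> h ` X}"
  have "?Z \<subseteq> C X" using h_eq_imp_mem[OF _ _ _ X] C_ext[OF X] by blast
  then have "C ?Z = C X" using X C_mono[of X ?Z] by (intro equalityI C_least) auto
  then show "a \<in> C X \<longleftrightarrow> h a \<in> D (h ` X)"
    using h_eq_imp_mem[OF _ a _ X] by (auto simp: D_def)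
qed (simp_all add: hom_h carrier_B)

text \<open>\<open>C ?Z\<close> is a union of kernel classes, so taking the preimage of its image
  adds nothing.\<close>

lemma vimage_D: "{a \<in> carrier A. h a \<in> D Y} = C {a \<in> carrier A. h a \<in> Y}" (is "_ = C ?Z")
  using h_eq_imp_mem[of _ _ ?Z] C_carrier[of ?Z] by (auto simp: D_def)

lemma D_closed_iff:
  assumes "Y \<subseteq> carrier B"
  shows "D Y = Y \<longleftrightarrow> C {a \<in> carrier A. h a \<in> Y} = {a \<in> carrier A. h a \<in> Y}" (is "_ \<longleftrightarrow> C ?Z = ?Z")
proof
  assume "D Y = Y"
  then show "C ?Z = ?Z" using vimage_D[of Y] by simp
next
  assume "C ?Z = ?Z"
  then show "D Y = Y" using assms by (auto simp: D_def carrier_B)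
qed

lemma abstract_logic_B: "abstract_logic B D"
  unfolding abstract_logic_def closure_operator_on_def
proof (intro conjI allI impI algebra_B)
  fix Y assume Y: "Y \<subseteq> carrier B"
  let ?Z = "{a \<in> carrier A. h a \<in> Y}"
  have Z: "?Z \<subseteq> carrier A" by auto
  show "D Y \<subseteq> carrier B" using C_carrier[OF Z] by (auto simp: D_def carrier_B)
  have "Y = h ` ?Z" using Y by (auto simp: carrier_B)
  then show "Y \<subseteq> D Y" using image_mono[OF C_ext[OF Z], of h] by (simp add: D_def)
  show "D (D Y) = D Y" using vimage_D[of Y] C_idem[OF Z] by (simp add: D_def[of "D Y"]) (simp add: D_def)
next
  fix X Y assume "X \<subseteq> Y" "Y \<subseteq> carrier B"
  then show "D X \<subseteq> D Y" unfolding D_def by (intro image_mono C_mono) auto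
qed

text \<open>By (PC) the conjunction of the elements of \<open>X\<close> has the closure of
  \<open>X\<close>, and filters are closed under conjunction. The empty set is excluded because
  \<open>C {}\<close> is empty while \<open>C {c}\<close> contains \<open>c\<close>.\<close>

lemma finite_meet:
  assumes "finite X" "X \<noteq> {}" "X \<subseteq> Z" "LB_filter A Z"
  shows "\<exists>c\<in>Z. C {c} = C X"
  using assms(1-3)
proof (induction rule: finite_ne_induct)
  case (insert x X)
  interpret filter_on A Z using assms(4) alg by unfold_locales
  have Z: "Z \<subseteq> carrier A" using assms(4) by (simp add: LB_filter_def)
  obtain c where c: "c \<in> Z" "C {c} = C X" using insert by auto
  have "C {x \<^bold>\<and>\<^bsub>A\<^esub> c} = C ({x} \<union> {c})"
    using C_land[of x c] c(1) insert.prems Z by (auto simp: insert_commute)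
  also have "\<dots> = C (C {x} \<union> C {c})" using c(1) insert.prems Z by (intro C_Un_C[symmetric]) auto
  also have "\<dots> = C ({x} \<union> X)" using c insert.prems Z by (simp only: c(2)) (intro C_Un_C; auto)
  finally have "C {x \<^bold>\<and>\<^bsub>A\<^esub> c} = C (insert x X)" by simp
  moreover have "x \<^bold>\<and>\<^bsub>A\<^esub> c \<in> Z" using land_iff[of x c] c(1) insert.prems Z by auto
  ultimately show ?case by blast
qed auto

text \<open>Finitarity and \<open>finite_meet\<close> reduce a consequence of the pulled-back filter
  \<open>Z\<close> to a consequence \<open>a\<close> of a single \<open>c\<close> in
  \<open>Z\<close>. The step from \<open>c\<close> to \<open>a\<close> uses that membership in
  \<open>Z\<close> is invariant under the kernel of \<open>h\<close>.\<close>

lemma filter_is_closed: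
  assumes Y: "LB_filter B Y"
  shows "D Y = Y"
proof -
  define Z where "Z = {a \<in> carrier A. h a \<in> Y}"
  have YB: "Y \<subseteq> carrier B" using Y by (simp add: LB_filter_def)
  have Z: "LB_filter A Z"
    using LB_filter_vimage_iff[OF alg hom_h carrier_B[symmetric] YB] Y by (simp add: Z_def)
  interpret filter_on A Z using Z alg by unfold_locales
  have ZA: "Z \<subseteq> carrier A" by (auto simp: Z_def)
  have "a \<in> Z" if a: "a \<in> C Z" for a
  proof -
    obtain X where X: "X \<subseteq> Z" "finite X" "a \<in> C X"
      using finitaryE[OF a ZA] .
    \<comment> \<open>By (E) nothing is derived from no premises.\<close>
    then have "X \<noteq> {}" using C_empty by auto
    then obtain c where c: "c \<in> Z" "C {c} = C X" using finite_meet[OF X(2) _ X(1) Z] by blast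
    have A: "a \<in> carrier A" "c \<in> carrier A" using c(1) a ZA C_carrier[OF ZA] by auto
    have ac: "a \<in> C {c}" using c X by simp
    have sub: "C {c, x} = C {c}" if "x \<in> C {c}" for x
    proof
      have "x \<in> carrier A" using that A C_carrier[of "{c}"] by auto
      then show "C {c} \<subseteq> C {c, x}" using A by (intro C_mono) auto
      show "C {c, x} \<subseteq> C {c}" using that A C_ext[of "{c}"] by (intro C_least) auto
    qed
    have "c \<oplus>\<^bsub>A\<^esub> a \<in> C {c}" using C_ext[of "{c \<oplus>\<^bsub>A\<^esub> a}"] C_oplus[of c a] A by auto
    \<comment> \<open>First components: both conjunctions generate \<open>C {c}\<close>, which
      contains \<open>a\<close> and \<open>c \<oplus> a\<close>. Second components: (PDM) and (PDI)
      give the closure of \<open>\<not>c\<close> intersected with that of \<open>\<not>a\<close>,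
      once with a repeated factor. With \<open>\<or>\<close> for \<open>\<oplus>\<close>, negation
      would produce a join instead, and the components could differ.\<close>
    then have "h (c \<^bold>\<and>\<^bsub>A\<^esub> (c \<oplus>\<^bsub>A\<^esub> a)) = h (c \<^bold>\<and>\<^bsub>A\<^esub> a)"
      using A sub[of a] sub[of "c \<oplus>\<^bsub>A\<^esub> a"] ac by (simp add: h_def C_land C_lneg Int_left_absorb)
    \<comment> \<open>The filter rules place the left side in \<open>Z\<close>. Being a preimage
      under \<open>h\<close>, \<open>Z\<close> then contains the right side, and with it
      \<open>a\<close>.\<close>
    moreover have "c \<^bold>\<and>\<^bsub>A\<^esub> (c \<oplus>\<^bsub>A\<^esub> a) \<in> Z"
      using A c(1) by (simp add: land_iff oplus_iff lorI1)
    ultimately have "c \<^bold>\<and>\<^bsub>A\<^esub> a \<in> Z" using A by (simp add: Z_def)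
    then show ?thesis using A by (simp add: land_iff)
  qed
  then have "C Z = Z" using C_ext[OF ZA] by blast
  then show ?thesis using D_closed_iff[OF YB] by (simp add: Z_def)
qed

text \<open>A \<open>D\<close>-closed set has a \<open>C\<close>-closed preimage, which is a filter,
  and this descends along \<open>h\<close>; the converse is \<open>filter_is_closed\<close>. Since
  \<open>B\<close> lives on pairs of sets, \<open>full_modelI\<close> moves the target to the type
  of \<open>A\<close>.\<close>

lemma full_model: "full_model A C"
proof (rule full_modelI)
  have "Y \<in> closure_system (carrier B) D \<longleftrightarrow> LB_filter B Y" for Y
  proof
    assume "Y \<in> closure_system (carrier B) D"
    then have Y: "Y \<subseteq> carrier B" "D Y = Y" by (auto simp: closure_system_def)
    then show "LB_filter B Y"
      using LB_filter_vimage_iff[OF alg hom_h carrier_B[symmetric] Y(1)] D_closed_iff[OF Y(1)]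
        closed_is_filter[of "{a \<in> carrier A. h a \<in> Y}"] by auto
  next
    assume "LB_filter B Y"
    then show "Y \<in> closure_system (carrier B) D"
      using filter_is_closed by (simp add: closure_system_def LB_filter_def)
  qed
  then show "full_model_via A C B D h"
    using abstract_logic_B bilogical_h by (auto simp: full_model_via_def)
qed

end

theorem theorem3p4p11:
  fixes A :: "'a alg" and C :: "'a set \<Rightarrow> 'a set"
  assumes "abstract_logic A C"
  shows "full_model A C \<longleftrightarrow>
    finitary A C \<and>
    C {} = {} \<and>
    (\<forall>a \<in> carrier A. \<forall>b \<in> carrier A.
       C {a \<^bold>\<and>\<^bsub>A\<^esub> b} = C {a \<otimes>\<^bsub>A\<^esub> b} \<and> C {a \<otimes>\<^bsub>A\<^esub> b} = C {a, b}) \<and>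
    (\<forall>X a b. X \<subseteq> carrier A \<longrightarrow> a \<in> carrier A \<longrightarrow> b \<in> carrier A \<longrightarrow>
       C (X \<union> {a \<^bold>\<or>\<^bsub>A\<^esub> b}) = C (X \<union> {a \<oplus>\<^bsub>A\<^esub> b}) \<and>
       C (X \<union> {a \<oplus>\<^bsub>A\<^esub> b}) = C (X \<union> {a}) \<inter> C (X \<union> {b})) \<and>
    (\<forall>a \<in> carrier A. C {a} = C {\<^bold>\<not>\<^bsub>A\<^esub> (\<^bold>\<not>\<^bsub>A\<^esub> a)}) \<and>
    (\<forall>a \<in> carrier A. \<forall>b \<in> carrier A.
       C {\<^bold>\<not>\<^bsub>A\<^esub> (a \<^bold>\<and>\<^bsub>A\<^esub> b)} = C {(\<^bold>\<not>\<^bsub>A\<^esub> a) \<^bold>\<or>\<^bsub>A\<^esub> (\<^bold>\<not>\<^bsub>A\<^esub> b)} \<and>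
       C {\<^bold>\<not>\<^bsub>A\<^esub> (a \<^bold>\<or>\<^bsub>A\<^esub> b)} = C {(\<^bold>\<not>\<^bsub>A\<^esub> a) \<^bold>\<and>\<^bsub>A\<^esub> (\<^bold>\<not>\<^bsub>A\<^esub> b)} \<and>
       C {\<^bold>\<not>\<^bsub>A\<^esub> (a \<otimes>\<^bsub>A\<^esub> b)} = C {(\<^bold>\<not>\<^bsub>A\<^esub> a) \<otimes>\<^bsub>A\<^esub> (\<^bold>\<not>\<^bsub>A\<^esub> b)} \<and>
       C {\<^bold>\<not>\<^bsub>A\<^esub> (a \<oplus>\<^bsub>A\<^esub> b)} = C {(\<^bold>\<not>\<^bsub>A\<^esub> a) \<oplus>\<^bsub>A\<^esub> (\<^bold>\<not>\<^bsub>A\<^esub> b)})"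
proof -
  have "full_model A C" if "finitary A C" "LB_properties A C"
  proof -
    interpret LB_logic A C using assms that by unfold_locales
    show ?thesis by (rule full_model)
  qed
  then have props: "full_model A C \<longleftrightarrow> finitary A C \<and> LB_properties A C"
    using full_model_properties[OF assms] by blast
  \<comment> \<open>The statement chains its equalities through a middle term, whereas
    \<open>LB_properties\<close> gives each term its value separately.\<close>
  have conj: "C {a \<^bold>\<and>\<^bsub>A\<^esub> b} = Y \<and> C {a \<otimes>\<^bsub>A\<^esub> b} = Y \<longleftrightarrow>
      C {a \<^bold>\<and>\<^bsub>A\<^esub> b} = C {a \<otimes>\<^bsub>A\<^esub> b} \<and> C {a \<otimes>\<^bsub>A\<^esub> b} = Y" for a b Y
    by blast
  have disj: "C (insert (a \<^bold>\<or>\<^bsub>A\<^esub> b) X) = Y \<and> C (insert (a \<oplus>\<^bsub>A\<^esub> b) X) = Y \<longleftrightarrow>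
      C (insert (a \<^bold>\<or>\<^bsub>A\<^esub> b) X) = C (insert (a \<oplus>\<^bsub>A\<^esub> b) X) \<and>
      C (insert (a \<oplus>\<^bsub>A\<^esub> b) X) = Y" for a b X Y
    by blast
  have neg: "C {\<^bold>\<not>\<^bsub>A\<^esub> (\<^bold>\<not>\<^bsub>A\<^esub> a)} = C {a} \<longleftrightarrow> C {a} = C {\<^bold>\<not>\<^bsub>A\<^esub> (\<^bold>\<not>\<^bsub>A\<^esub> a)}" for a
    by (rule eq_commute)
  show ?thesis
    by (simp only: props LB_properties_def Un_insert_right sup_bot_right conj disj neg)
qed

end
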